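(* For a finite $\Delta$-complex $X$, a core of $X$ is uniquely determined up to isomorphism; that is, any two cores of $X$ are isomorphic $\Delta$-complexes.
   Context: For a set $S$, $2^S_n$ is the set of subsets of $S$ with exactly $n+1$ elements. A $\Delta$-complex $X$ consists of sets $X_n$ ($n\ge 0$); maps $V\colon X_n\to 2^{X_0}_n$, with $V(v)=\{v\}$ for $v\in X_0$; and, for $n\ge1$ and $v\in X_0$, a map $d_v\colon X_n(v)\to X_{n-1}$, where $X_n(v)=\{\sigma\in X_n: v\in V(\sigma)\}$, such that (1) $V(d_v\sigma)=V(\sigma)\setminus\{v\}$ for $n\ge 1$, and (2) $d_vd_w\sigma=d_wd_v\sigma$ for $\sigma\in X_n$, $n\ge2$, and distinct $v,w\in V(\sigma)$. It is finite if it has finitely many simplices in total. Elements of $X_n$ are $n$-simplices; elements of $X_0$ are vertices. Let $\preceq$ be the partial order on the set of all simplices generated by $d_v(\tau)\preceq\tau$ for $v\in V(\tau)$. A subcomplex $Y$ of $X$ is a $\Delta$-complex with $Y_n\subset X_n$ whose maps $V$ and $d_v$ are restrictions of those of $X$. For a vertex $v$, $X\setminus v$ is the subcomplex obtained by deleting all simplices $\sigma$ with $v\preceq\sigma$. An isomorphism $X\to Y$ of $\Delta$-complexes is a family of bijections $f\colon X_n\to Y_n$ with $V(f(\sigma))=f(V(\sigma))$ and $d_{f(w)}(f(\sigma))=f(d_w\sigma)$ for all $\sigma\in X_n$, $n\ge 1$, $w\in V(\sigma)$. A vertex $v$ is dominated by another vertex $v'$ if for every simplex $\sigma$ with $v\preceq\sigma$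 there is a unique simplex $\tau$ with $V(\tau)=V(\sigma)\cup\{v'\}$ and $\sigma\preceq\tau$; $v$ is dominated if it is dominated by some other vertex. If $v$ is dominated there is an elementary strong collapse from $X$ to $X\setminus v$. There is a strong collapse from $X$ to a subcomplex $Y$ if there is a (possibly empty) finite sequence of elementary strong collapses starting in $X$ and ending in $Y$. $X$ is minimal if it has no dominated vertex. A core of $X$ is a subcomplex $Y$ which is minimal and such that there is a strong collapse from $X$ to $Y$. *)

theory Defs
  imports "HOL-Library.FuncSet"
begin

text \<open>
  The sets \<open>X\<^sub>n\<close> are subsets of one type and need not be disjoint, so every structure map carries
  the dimension as an index, and an element of the set of all simplices (a disjoint union) is a pair
  \<open>(n, \<sigma>)\<close>. The maps \<open>d\<^sub>v\<close>, which exist on \<open>X\<^sub>n\<close> for \<open>n \<ge> 1\<close> only, are indexed by the dimension of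
  their target: \<open>face X n v\<close> is \<open>d\<^sub>v : X\<^sub>n\<^sub>+\<^sub>1(v) \<rightarrow> X\<^sub>n\<close>.
\<close>

record 'a delta_complex =
  simplices :: "nat \<Rightarrow> 'a set"
  vset :: "nat \<Rightarrow> 'a \<Rightarrow> 'a set"
  face :: "nat \<Rightarrow> 'a \<Rightarrow> 'a \<Rightarrow> 'a"

definition simplices_at :: "'a delta_complex \<Rightarrow> nat \<Rightarrow> 'a \<Rightarrow> 'a set" where
  "simplices_at X n v = {\<sigma> \<in> simplices X n. v \<in> vset X n \<sigma>}"

text \<open>
  All structure maps are extensional (\<open>\<rightarrow>\<^sub>E\<close>), so that a complex is determined by its data and
  equality of records is equality of complexes. In the axioms for \<open>face\<close>, the domain
  \<open>simplices_at X (Suc n) v\<close> is empty unless \<open>v\<close> is a vertex.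
\<close>

definition is_delta_complex :: "'a delta_complex \<Rightarrow> bool" where
  "is_delta_complex X \<longleftrightarrow>
     (\<forall>n. vset X n \<in> simplices X n \<rightarrow>\<^sub>E {A. A \<subseteq> simplices X 0 \<and> card A = n + 1}) \<and>
     (\<forall>v \<in> simplices X 0. vset X 0 v = {v}) \<and>
     (\<forall>n v. face X n v \<in> simplices_at X (Suc n) v \<rightarrow>\<^sub>E simplices X n) \<and>
     (\<forall>n v. \<forall>\<sigma> \<in> simplices_at X (Suc n) v.
        vset X n (face X n v \<sigma>) = vset X (Suc n) \<sigma> - {v}) \<and>
     (\<forall>n. \<forall>\<sigma> \<in> simplices X (Suc (Suc n)).
        \<forall>v \<in> vset X (Suc (Suc n)) \<sigma>. \<forall>w \<in> vset X (Suc (Suc n)) \<sigma>. v \<noteq> w \<longrightarrow>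
          face X n v (face X (Suc n) w \<sigma>) = face X n w (face X (Suc n) v \<sigma>))"

definition all_simplices :: "'a delta_complex \<Rightarrow> (nat \<times> 'a) set" where
  "all_simplices X = (SIGMA n : UNIV. simplices X n)"

definition finite_complex :: "'a delta_complex \<Rightarrow> bool" where
  "finite_complex X \<longleftrightarrow> finite (all_simplices X)"

definition face_rel :: "'a delta_complex \<Rightarrow> ((nat \<times> 'a) \<times> (nat \<times> 'a)) set" where
  "face_rel X = {((n, face X n v \<tau>), (Suc n, \<tau>)) | n v \<tau>.
     \<tau> \<in> simplices X (Suc n) \<and> v \<in> vset X (Suc n) \<tau>}"

definition face_le :: "'a delta_complex \<Rightarrow> nat \<times> 'a \<Rightarrow> nat \<times> 'a \<Rightarrow> bool" where
  "face_le X s t \<longleftrightarrow> s \<in> all_simplices X \<and> t \<in> all_simplices X \<and> (s, t) \<in> (face_rel X)\<^sup>*"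

text \<open>The simplices in \<open>S\<close> with the restrictions of the structure maps of \<open>X\<close>.\<close>

definition restrict_complex :: "'a delta_complex \<Rightarrow> (nat \<Rightarrow> 'a set) \<Rightarrow> 'a delta_complex" where
  "restrict_complex X S =
     \<lparr>simplices = S,
      vset = (\<lambda>n. restrict (vset X n) (S n)),
      face = (\<lambda>n v. restrict (face X n v) {\<sigma> \<in> S (Suc n). v \<in> vset X (Suc n) \<sigma>})\<rparr>"

definition subcomplex :: "'a delta_complex \<Rightarrow> 'a delta_complex \<Rightarrow> bool" where
  "subcomplex Y X \<longleftrightarrow>
     is_delta_complex Y \<and> (\<forall>n. simplices Y n \<subseteq> simplices X n) \<and>
     Y = restrict_complex X (simplices Y)"

definition delete_vertex :: "'a delta_complex \<Rightarrow> 'a \<Rightarrow> 'a delta_complex" where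
  "delete_vertex X v =
     restrict_complex X (\<lambda>n. {\<sigma> \<in> simplices X n. \<not> face_le X (0, v) (n, \<sigma>)})"

definition isomorphic :: "'a delta_complex \<Rightarrow> 'b delta_complex \<Rightarrow> bool" where
  "isomorphic X Y \<longleftrightarrow> (\<exists>f :: nat \<Rightarrow> 'a \<Rightarrow> 'b.
     (\<forall>n. bij_betw (f n) (simplices X n) (simplices Y n)) \<and>
     (\<forall>n. \<forall>\<sigma> \<in> simplices X (Suc n).
        vset Y (Suc n) (f (Suc n) \<sigma>) = f 0 ` vset X (Suc n) \<sigma> \<and>
        (\<forall>w \<in> vset X (Suc n) \<sigma>.
           face Y n (f 0 w) (f (Suc n) \<sigma>) = f n (face X n w \<sigma>))))"

definition dominated_by :: "'a delta_complex \<Rightarrow> 'a \<Rightarrow> 'a \<Rightarrow> bool" where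
  "dominated_by X v v' \<longleftrightarrow>
     v \<in> simplices X 0 \<and> v' \<in> simplices X 0 \<and> v' \<noteq> v \<and>
     (\<forall>(n, \<sigma>) \<in> all_simplices X. face_le X (0, v) (n, \<sigma>) \<longrightarrow>
        (\<exists>!(m, \<tau>). (m, \<tau>) \<in> all_simplices X \<and>
           vset X m \<tau> = vset X n \<sigma> \<union> {v'} \<and> face_le X (n, \<sigma>) (m, \<tau>)))"

definition dominated :: "'a delta_complex \<Rightarrow> 'a \<Rightarrow> bool" where
  "dominated X v \<longleftrightarrow> (\<exists>v'. dominated_by X v v')"

definition elementary_strong_collapse :: "'a delta_complex \<Rightarrow> 'a delta_complex \<Rightarrow> bool" where
  "elementary_strong_collapse X Y \<longleftrightarrow> (\<exists>v. dominated X v \<and> Y = delete_vertex X v)"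

definition strong_collapse :: "'a delta_complex \<Rightarrow> 'a delta_complex \<Rightarrow> bool" where
  "strong_collapse X Y \<longleftrightarrow> subcomplex Y X \<and> elementary_strong_collapse\<^sup>*\<^sup>* X Y"

definition minimal_complex :: "'a delta_complex \<Rightarrow> bool" where
  "minimal_complex X \<longleftrightarrow> \<not> (\<exists>v. dominated X v)"

definition is_core :: "'a delta_complex \<Rightarrow> 'a delta_complex \<Rightarrow> bool" where
  "is_core Y X \<longleftrightarrow> subcomplex Y X \<and> minimal_complex Y \<and> strong_collapse X Y"

end

theory Submission
  imports Defs
begin

text \<open>
  Induction on the number of vertices. Let \<open>v\<close> and \<open>w\<close> be distinct vertices, dominated by \<open>v'\<close> and
  \<open>w'\<close>. If \<open>v' = w\<close> and \<open>w' = v\<close>, then \<open>X - v\<close> and \<open>X - w\<close> are isomorphic: a simplex \<open>\<sigma>\<close> containing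
  \<open>w\<close> goes to \<open>d\<^sub>w(\<sigma> \<union> v)\<close>, where \<open>\<sigma> \<union> v\<close> is the unique extension of \<open>\<sigma>\<close> by \<open>v\<close>. Otherwise \<open>v\<close>
  remains dominated in \<open>X - w\<close> (by \<open>v'\<close>, or by \<open>w'\<close> if \<open>v' = w\<close>) and vice versa, so that both
  deletions continue to \<open>X - v - w\<close>. Thus strong collapses are locally confluent up to isomorphism.
\<close>

section \<open>Faces and vertices\<close>

locale delta_complex =
  fixes X :: "'a delta_complex"
  assumes complex: "is_delta_complex X"
begin

lemmas axiom_conjuncts = complex[unfolded is_delta_complex_def]
lemmas vset_PiE = axiom_conjuncts[THEN conjunct1, THEN spec]
  and face_PiE = axiom_conjuncts[THEN conjunct2, THEN conjunct2, THEN conjunct1, THEN spec, THEN spec]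

lemma vset_subset: "\<sigma> \<in> simplices X n \<Longrightarrow> vset X n \<sigma> \<subseteq> simplices X 0"
  and card_vset: "\<sigma> \<in> simplices X n \<Longrightarrow> card (vset X n \<sigma>) = Suc n"
proof -
  assume "\<sigma> \<in> simplices X n"
  then have "vset X n \<sigma> \<in> {A. A \<subseteq> simplices X 0 \<and> card A = n + 1}"
    by (rule PiE_mem[OF vset_PiE])
  then show "vset X n \<sigma> \<subseteq> simplices X 0" "card (vset X n \<sigma>) = Suc n"
    by auto
qed

lemma finite_vset: "\<sigma> \<in> simplices X n \<Longrightarrow> finite (vset X n \<sigma>)"
  using card_vset[of \<sigma> n] card.infinite by fastforce

lemma vset_0 [simp]: "v \<in> simplices X 0 \<Longrightarrow> vset X 0 v = {v}"
  using axiom_conjuncts[THEN conjunct2, THEN conjunct1] by (rule bspec)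

lemma face_in_simplices:
  assumes "\<sigma> \<in> simplices X (Suc n)" "v \<in> vset X (Suc n) \<sigma>"
  shows "face X n v \<sigma> \<in> simplices X n"
  using face_PiE by (rule PiE_mem) (simp add: simplices_at_def assms)

lemma vset_face:
  "\<lbrakk>\<sigma> \<in> simplices X (Suc n); v \<in> vset X (Suc n) \<sigma>\<rbrakk>
    \<Longrightarrow> vset X n (face X n v \<sigma>) = vset X (Suc n) \<sigma> - {v}"
  using axiom_conjuncts[THEN conjunct2, THEN conjunct2, THEN conjunct2, THEN conjunct1]
  by (simp add: simplices_at_def)

lemma face_commute:
  "\<lbrakk>\<sigma> \<in> simplices X (Suc (Suc n)); v \<in> vset X (Suc (Suc n)) \<sigma>; w \<in> vset X (Suc (Suc n)) \<sigma>; v \<noteq> w\<rbrakk>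
    \<Longrightarrow> face X n v (face X (Suc n) w \<sigma>) = face X n w (face X (Suc n) v \<sigma>)"
  using axiom_conjuncts[THEN conjunct2, THEN conjunct2, THEN conjunct2, THEN conjunct2] by simp

lemma vset_mono_face_rel:
  "(s, t) \<in> (face_rel X)\<^sup>* \<Longrightarrow> vset X (fst s) (snd s) \<subseteq> vset X (fst t) (snd t)"
  by (induction rule: rtrancl_induct) (auto simp: face_rel_def vset_face)

lemma fst_face_rel_pow: "(s, t) \<in> face_rel X ^^ k \<Longrightarrow> fst t = fst s + k"
  by (induction k arbitrary: t) (auto simp: face_rel_def)

text \<open>A chain from \<sigma> down to \<open>v\<close> arises by removing the other vertices one
  at a time: in positive dimension the vertex set has at least two elements, so some
  \<open>u\<close> other than \<open>v\<close> can go first.\<close>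

lemma vertex_face_rel:
  "\<lbrakk>\<sigma> \<in> simplices X n; v \<in> vset X n \<sigma>\<rbrakk> \<Longrightarrow> ((0, v), (n, \<sigma>)) \<in> (face_rel X)\<^sup>*"
proof (induction n arbitrary: \<sigma>)
  case 0
  then show ?case by simp
next
  case (Suc n)
  have "vset X (Suc n) \<sigma> \<noteq> {v}"
    using card_vset[OF Suc.prems(1)] by auto
  then obtain u where u: "u \<in> vset X (Suc n) \<sigma>" "u \<noteq> v"
    using Suc.prems(2) by blast
  have "((0, v), (n, face X n u \<sigma>)) \<in> (face_rel X)\<^sup>*"
    using Suc u by (simp add: face_in_simplices vset_face)
  moreover have "((n, face X n u \<sigma>), (Suc n, \<sigma>)) \<in> face_rel X"
    using Suc.prems u by (auto simp: face_rel_def)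
  ultimately show ?case by (rule rtrancl_into_rtrancl)
qed

text \<open>This trades the order for membership in the vertex set, in which deletion and domination
  are expressed from here on.\<close>

lemma vertex_face_le_iff:
  assumes "\<sigma> \<in> simplices X n" "v \<in> simplices X 0"
  shows "face_le X (0, v) (n, \<sigma>) \<longleftrightarrow> v \<in> vset X n \<sigma>"
  using assms vertex_face_rel[of \<sigma> n v] vset_mono_face_rel[of "(0, v)" "(n, \<sigma>)"]
  by (auto simp: face_le_def all_simplices_def)

end

section \<open>Domination and deletion of vertices\<close>

text \<open>These are the candidates for the extension of \<sigma> by \<open>u\<close> in the
  definition of domination. The membership of \<open>u\<close> must be demanded, since
  \<open>face\<close> takes the value \<open>undefined\<close> off its domain and that value might
  be \<sigma>.\<close>

definition cofaces :: "'a delta_complex \<Rightarrow> nat \<Rightarrow> 'a \<Rightarrow> 'a \<Rightarrow> 'a set" where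
  "cofaces X n u \<sigma> = {\<tau> \<in> simplices X (Suc n). u \<in> vset X (Suc n) \<tau> \<and> face X n u \<tau> = \<sigma>}"

context delta_complex
begin

lemma vset_cofaces: "\<tau> \<in> cofaces X n u \<sigma> \<Longrightarrow> vset X (Suc n) \<tau> = insert u (vset X n \<sigma>)"
  by (auto simp: cofaces_def vset_face)

text \<open>Counting vertices forces \<open>m = Suc n\<close>. Each step of a chain of faces changes
  the dimension by one, so the chain is a single step, and comparing vertex sets shows that the
  removed vertex is \<open>u\<close>.\<close>

lemma extension_iff:
  assumes \<sigma>: "\<sigma> \<in> simplices X n" and u: "u \<notin> vset X n \<sigma>"
  shows "((m, \<tau>) \<in> all_simplices X \<and> vset X m \<tau> = vset X n \<sigma> \<union> {u} \<and> face_le X (n, \<sigma>) (m, \<tau>))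
    \<longleftrightarrow> m = Suc n \<and> \<tau> \<in> cofaces X n u \<sigma>" (is "?L \<longleftrightarrow> ?R")
proof
  assume L: ?L
  then have \<tau>: "\<tau> \<in> simplices X m" by (simp add: all_simplices_def)
  have "Suc m = Suc (Suc n)"
    using card_vset[OF \<tau>] card_vset[OF \<sigma>] L u finite_vset[OF \<sigma>] by simp
  then have m: "m = Suc n" by simp
  obtain k where k: "((n, \<sigma>), (m, \<tau>)) \<in> face_rel X ^^ k"
    using L by (auto simp: face_le_def dest: rtrancl_imp_relpow)
  then have "k = 1" using fst_face_rel_pow[OF k] m by simp
  then obtain v where v: "v \<in> vset X (Suc n) \<tau>" "\<sigma> = face X n v \<tau>"
    using k m by (auto simp: face_rel_def)
  then have "v = u"
    using L vset_face[of \<tau> n v] \<tau> m by auto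
  then show ?R using v \<tau> m by (simp add: cofaces_def)
next
  assume R: ?R
  then have "((n, \<sigma>), (m, \<tau>)) \<in> face_rel X"
    by (auto simp: face_rel_def cofaces_def)
  then show ?L
    using R \<sigma> vset_cofaces[of \<tau> n u \<sigma>]
    by (auto simp: face_le_def all_simplices_def cofaces_def)
qed

text \<open>The same count leaves only the chain of length 0. Hence domination by \<open>u\<close>
  imposes nothing on simplices that already contain \<open>u\<close>.\<close>

lemma extension_trivial:
  assumes \<sigma>: "\<sigma> \<in> simplices X n" and u: "u \<in> vset X n \<sigma>"
  shows "((m, \<tau>) \<in> all_simplices X \<and> vset X m \<tau> = vset X n \<sigma> \<union> {u} \<and> face_le X (n, \<sigma>) (m, \<tau>))
    \<longleftrightarrow> (m, \<tau>) = (n, \<sigma>)" (is "?L \<longleftrightarrow> ?R")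
proof
  assume L: ?L
  then have \<tau>: "\<tau> \<in> simplices X m" by (simp add: all_simplices_def)
  have m: "m = n"
    using card_vset[OF \<tau>] card_vset[OF \<sigma>] L u by (simp add: insert_absorb)
  obtain k where k: "((n, \<sigma>), (m, \<tau>)) \<in> face_rel X ^^ k"
    using L by (auto simp: face_le_def dest: rtrancl_imp_relpow)
  then have "k = 0" using fst_face_rel_pow[OF k] m by simp
  then show ?R using k by simp
next
  assume ?R
  then show ?L using \<sigma> u by (auto simp: face_le_def all_simplices_def)
qed

lemma dominated_by_iff:
  "dominated_by X v u \<longleftrightarrow> v \<in> simplices X 0 \<and> u \<in> simplices X 0 \<and> u \<noteq> v \<and>
    (\<forall>n. \<forall>\<sigma> \<in> simplices X n. v \<in> vset X n \<sigma> \<longrightarrow> u \<notin> vset X n \<sigma> \<longrightarrow> (\<exists>!\<tau>. \<tau> \<in> cofaces X n u \<sigma>))"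
proof (cases "v \<in> simplices X 0")
  case True
  have "(\<exists>!(m, \<tau>). (m, \<tau>) \<in> all_simplices X \<and> vset X m \<tau> = vset X n \<sigma> \<union> {u} \<and> face_le X (n, \<sigma>) (m, \<tau>))
      \<longleftrightarrow> (u \<notin> vset X n \<sigma> \<longrightarrow> (\<exists>!\<tau>. \<tau> \<in> cofaces X n u \<sigma>))"
    if \<sigma>: "\<sigma> \<in> simplices X n" for n \<sigma>
  proof (cases "u \<in> vset X n \<sigma>")
    case True
    then show ?thesis by (simp only: extension_trivial[OF \<sigma> True]) auto
  next
    case False
    then show ?thesis by (simp only: extension_iff[OF \<sigma> False]) auto
  qed
  then show ?thesis
    unfolding dominated_by_def using True
    by (auto simp: all_simplices_def vertex_face_le_iff)
qed (simp add: dominated_by_def)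

lemma dominated_byD:
  assumes "dominated_by X v u"
  shows "v \<in> simplices X 0" "u \<in> simplices X 0" "u \<noteq> v"
    and "\<lbrakk>\<sigma> \<in> simplices X n; v \<in> vset X n \<sigma>; u \<notin> vset X n \<sigma>\<rbrakk> \<Longrightarrow> \<exists>\<tau>. \<tau> \<in> cofaces X n u \<sigma>"
    and "\<lbrakk>\<tau> \<in> cofaces X n u \<sigma>; \<tau>' \<in> cofaces X n u \<sigma>; v \<in> vset X n \<sigma>\<rbrakk> \<Longrightarrow> \<tau> = \<tau>'"
proof -
  note D = assms[unfolded dominated_by_iff]
  show "v \<in> simplices X 0" "u \<in> simplices X 0" "u \<noteq> v"
    using D by auto
  show "\<lbrakk>\<sigma> \<in> simplices X n; v \<in> vset X n \<sigma>; u \<notin> vset X n \<sigma>\<rbrakk> \<Longrightarrow> \<exists>\<tau>. \<tau> \<in> cofaces X n u \<sigma>"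
    using D by blast
  \<comment> \<open>Being a face \<open>d_u \<tau>\<close> already makes \<sigma> a simplex without
    \<open>u\<close>, so uniqueness can be used without these two side conditions.\<close>
  assume *: "\<tau> \<in> cofaces X n u \<sigma>" "\<tau>' \<in> cofaces X n u \<sigma>" "v \<in> vset X n \<sigma>"
  then have "\<sigma> \<in> simplices X n" "u \<notin> vset X n \<sigma>"
    by (auto simp: cofaces_def face_in_simplices vset_face)
  then show "\<tau> = \<tau>'" using D * by blast
qed

section \<open>The complex that remains after deleting a vertex\<close>

lemma simplices_delete_vertex:
  assumes "v \<in> simplices X 0"
  shows "simplices (delete_vertex X v) n = {\<sigma> \<in> simplices X n. v \<notin> vset X n \<sigma>}"
  using assms by (auto simp: delete_vertex_def restrict_complex_def vertex_face_le_iff)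

lemma vset_delete_vertex:
  assumes "\<sigma> \<in> simplices (delete_vertex X v) n"
  shows "vset (delete_vertex X v) n \<sigma> = vset X n \<sigma>"
  using assms by (simp add: delete_vertex_def restrict_complex_def)

lemma face_delete_vertex:
  assumes "\<sigma> \<in> simplices (delete_vertex X v) (Suc n)" "u \<in> vset X (Suc n) \<sigma>"
  shows "face (delete_vertex X v) n u \<sigma> = face X n u \<sigma>"
  using assms by (simp add: delete_vertex_def restrict_complex_def)

lemma face_in_delete_vertex:
  assumes "v \<in> simplices X 0" "\<sigma> \<in> simplices (delete_vertex X v) (Suc n)" "u \<in> vset X (Suc n) \<sigma>"
  shows "face X n u \<sigma> \<in> simplices (delete_vertex X v) n"
  using assms by (simp add: simplices_delete_vertex face_in_simplices vset_face)

text \<open>Vertices and faces of a simplex avoiding \<open>v\<close> also avoid \<open>v\<close>,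
  so the axioms are inherited from \<open>X\<close>; extensionality comes from the restrictions in
  \<open>restrict_complex\<close>.\<close>

lemma delta_complex_delete_vertex:
  assumes v: "v \<in> simplices X 0"
  shows "delta_complex (delete_vertex X v)"
proof
  let ?Y = "delete_vertex X v"
  have in_X: "\<sigma> \<in> simplices X n" if "\<sigma> \<in> simplices ?Y n" for n \<sigma>
    using that simplices_delete_vertex[OF v] by simp
  have "vset ?Y n \<in> simplices ?Y n \<rightarrow>\<^sub>E {A. A \<subseteq> simplices ?Y 0 \<and> card A = n + 1}" for n
  proof
    fix \<sigma> assume \<sigma>: "\<sigma> \<in> simplices ?Y n"
    then have "vset X n \<sigma> \<subseteq> simplices ?Y 0"
      using vset_subset[OF in_X[OF \<sigma>]] by (auto simp: simplices_delete_vertex[OF v])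
    then show "vset ?Y n \<sigma> \<in> {A. A \<subseteq> simplices ?Y 0 \<and> card A = n + 1}"
      using card_vset[OF in_X[OF \<sigma>]] by (simp add: vset_delete_vertex[OF \<sigma>])
  qed (auto simp: delete_vertex_def restrict_complex_def)
  moreover have "vset ?Y 0 u = {u}" if "u \<in> simplices ?Y 0" for u
    using vset_delete_vertex[OF that] in_X[OF that] by simp
  moreover have "face ?Y n u \<in> simplices_at ?Y (Suc n) u \<rightarrow>\<^sub>E simplices ?Y n" for n u
  proof
    fix \<sigma> assume "\<sigma> \<in> simplices_at ?Y (Suc n) u"
    then show "face ?Y n u \<sigma> \<in> simplices ?Y n"
      by (auto simp: simplices_at_def vset_delete_vertex face_delete_vertex face_in_delete_vertex[OF v])
  next
    fix \<sigma> assume "\<sigma> \<notin> simplices_at ?Y (Suc n) u"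
    then show "face ?Y n u \<sigma> = undefined"
      by (auto simp: simplices_at_def delete_vertex_def restrict_complex_def)
  qed
  moreover have "vset ?Y n (face ?Y n u \<sigma>) = vset ?Y (Suc n) \<sigma> - {u}"
    if "\<sigma> \<in> simplices_at ?Y (Suc n) u" for n u \<sigma>
    using that
    by (auto simp: simplices_at_def vset_delete_vertex face_delete_vertex
        face_in_delete_vertex[OF v] vset_face[OF in_X])
  moreover have "face ?Y n u (face ?Y (Suc n) w \<sigma>) = face ?Y n w (face ?Y (Suc n) u \<sigma>)"
    if "\<sigma> \<in> simplices ?Y (Suc (Suc n))" "u \<in> vset ?Y (Suc (Suc n)) \<sigma>"
      "w \<in> vset ?Y (Suc (Suc n)) \<sigma>" "u \<noteq> w" for n u w \<sigma>
    using that
    by (auto simp: vset_delete_vertex face_delete_vertex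
        face_in_delete_vertex[OF v] vset_face[OF in_X] face_commute[OF in_X])
  ultimately show "is_delta_complex ?Y"
    unfolding is_delta_complex_def by (intro conjI allI ballI impI)
qed

text \<open>A coface has vertex set \<open>insert u (vset X n \<sigma>)\<close>, which avoids
  \<open>v\<close>; so the deletion loses none of them.\<close>

lemma cofaces_delete_vertex:
  assumes "v \<in> simplices X 0" "v \<noteq> u" "v \<notin> vset X n \<sigma>"
  shows "cofaces (delete_vertex X v) n u \<sigma> = cofaces X n u \<sigma>"
proof (intro set_eqI iffI)
  fix \<tau>
  show "\<tau> \<in> cofaces X n u \<sigma>" if "\<tau> \<in> cofaces (delete_vertex X v) n u \<sigma>"
    using that assms
    by (auto simp: cofaces_def vset_delete_vertex face_delete_vertex simplices_delete_vertex)
  assume \<tau>: "\<tau> \<in> cofaces X n u \<sigma>"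
  then have "\<tau> \<in> simplices (delete_vertex X v) (Suc n)"
    using vset_cofaces[OF \<tau>] assms by (simp add: cofaces_def simplices_delete_vertex)
  then show "\<tau> \<in> cofaces (delete_vertex X v) n u \<sigma>"
    using \<tau> by (simp add: cofaces_def vset_delete_vertex face_delete_vertex)
qed

text \<open>Both sides are the restriction of \<open>X\<close> to the simplices avoiding both
  vertices. Extensionality of the maps gives equality of records here, not merely an
  isomorphism.\<close>

lemma delete_vertex_commute:
  assumes v: "v \<in> simplices X 0" and w: "w \<in> simplices X 0" and "v \<noteq> w"
  shows "delete_vertex (delete_vertex X v) w = delete_vertex (delete_vertex X w) v"
proof -
  have simplices2: "simplices (delete_vertex (delete_vertex X a) b) n =
      {\<sigma> \<in> simplices X n. a \<notin> vset X n \<sigma> \<and> b \<notin> vset X n \<sigma>}"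
    if a: "a \<in> simplices X 0" and b: "b \<in> simplices X 0" and "a \<noteq> b" for a b n
  proof -
    interpret Y: delta_complex "delete_vertex X a" by (rule delta_complex_delete_vertex[OF a])
    have "b \<in> simplices (delete_vertex X a) 0"
      using that by (simp add: simplices_delete_vertex)
    then have "simplices (delete_vertex (delete_vertex X a) b) n =
        {\<sigma> \<in> simplices (delete_vertex X a) n. b \<notin> vset X n \<sigma>}"
      by (auto simp: Y.simplices_delete_vertex vset_delete_vertex)
    then show ?thesis
      by (auto simp: simplices_delete_vertex[OF a])
  qed
  have restrict2: "restrict_complex (restrict_complex X S) T = restrict_complex X T"
    if "\<And>n. T n \<subseteq> S n" for S T
    using that
    by (fastforce simp: restrict_complex_def restrict_def fun_eq_iff)
  have *: "delete_vertex (delete_vertex X a) b = restrict_complex X (simplices (delete_vertex (delete_vertex X a) b))"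
    for a b
    unfolding delete_vertex_def
    by (subst restrict2) (auto simp: restrict_complex_def)
  have "simplices (delete_vertex (delete_vertex X v) w) = simplices (delete_vertex (delete_vertex X w) v)"
    using assms by (auto simp: simplices2)
  then show ?thesis
    using *[of v w] *[of w v] by simp
qed

section \<open>Domination after a deletion\<close>

text \<open>Deleting \<open>w\<close> only shrinks the set of simplices to be tested: as
  \<open>w\<close> differs from \<open>u\<close>, the cofaces by \<open>u\<close> of a simplex
  avoiding \<open>w\<close> are the same as in \<open>X\<close>.\<close>

lemma dominated_by_delete_vertex_iff:
  assumes w: "w \<in> simplices X 0" "w \<noteq> v" "w \<noteq> u"
  shows "dominated_by (delete_vertex X w) v u \<longleftrightarrow>
    v \<in> simplices X 0 \<and> u \<in> simplices X 0 \<and> u \<noteq> v \<and>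
    (\<forall>n. \<forall>\<sigma> \<in> simplices X n. w \<notin> vset X n \<sigma> \<longrightarrow> v \<in> vset X n \<sigma> \<longrightarrow> u \<notin> vset X n \<sigma> \<longrightarrow>
      (\<exists>!\<tau>. \<tau> \<in> cofaces X n u \<sigma>))"
proof -
  interpret Y: delta_complex "delete_vertex X w" by (rule delta_complex_delete_vertex[OF w(1)])
  have "a \<in> simplices (delete_vertex X w) 0 \<longleftrightarrow> a \<in> simplices X 0" if "a \<noteq> w" for a
    using that w by (auto simp: simplices_delete_vertex)
  moreover have "(\<forall>\<sigma> \<in> simplices (delete_vertex X w) n. v \<in> vset (delete_vertex X w) n \<sigma> \<longrightarrow>
        u \<notin> vset (delete_vertex X w) n \<sigma> \<longrightarrow> (\<exists>!\<tau>. \<tau> \<in> cofaces (delete_vertex X w) n u \<sigma>)) \<longleftrightarrow>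
      (\<forall>\<sigma> \<in> simplices (delete_vertex X w) n. v \<in> vset X n \<sigma> \<longrightarrow>
        u \<notin> vset X n \<sigma> \<longrightarrow> (\<exists>!\<tau>. \<tau> \<in> cofaces X n u \<sigma>))" for n
    using w
    by (intro ball_cong refl)
      (simp add: vset_delete_vertex, simp add: simplices_delete_vertex cofaces_delete_vertex)
  ultimately show ?thesis
    using w unfolding Y.dominated_by_iff by (simp add: simplices_delete_vertex) blast
qed

lemma dominated_by_delete_vertex:
  assumes "dominated_by X v u" "w \<in> simplices X 0" "w \<noteq> v" "w \<noteq> u"
  shows "dominated_by (delete_vertex X w) v u"
  using assms unfolding dominated_by_delete_vertex_iff[OF assms(2-4)] dominated_by_iff by blast

text \<open>This is the commuting square of faces:
  \<open>d_a (d_b \<rho>) = d_b (d_a \<rho>) = d_b \<tau>\<close>.\<close>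

lemma cofaces_face:
  assumes \<rho>: "\<rho> \<in> cofaces X (Suc n) a \<tau>" and b: "b \<in> vset X (Suc n) \<tau>"
  shows "face X (Suc n) b \<rho> \<in> cofaces X n a (face X n b \<tau>)"
proof -
  have *: "\<rho> \<in> simplices X (Suc (Suc n))" "a \<in> vset X (Suc (Suc n)) \<rho>" "face X (Suc n) a \<rho> = \<tau>"
    using \<rho> by (auto simp: cofaces_def)
  then have "b \<in> vset X (Suc (Suc n)) \<rho>" "b \<noteq> a"
    using b vset_face[of \<rho> "Suc n" a] by auto
  then show ?thesis
    using * face_commute[of \<rho> n a b]
    by (auto simp: cofaces_def face_in_simplices vset_face)
qed

text \<open>To extend \<sigma> by \<open>u\<close>, add \<open>w\<close> (as \<sigma> contains
  \<open>v\<close>), then \<open>u\<close> (as the result contains \<open>w\<close>), and remove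
  \<open>w\<close> again. The case \<open>u = v\<close>, excluded here, is mutual
  domination.\<close>

lemma dominated_by_trans:
  assumes vw: "dominated_by X v w" and wu: "dominated_by X w u" and "u \<noteq> v"
  shows "dominated_by (delete_vertex X w) v u"
proof -
  have w: "w \<in> simplices X 0" and u: "u \<in> simplices X 0" and v: "v \<in> simplices X 0"
    and uw: "u \<noteq> w" and wv: "w \<noteq> v"
    using dominated_byD[OF vw] dominated_byD[OF wu] by auto
  have "\<exists>!\<tau>. \<tau> \<in> cofaces X n u \<sigma>"
    if \<sigma>: "\<sigma> \<in> simplices X n" "w \<notin> vset X n \<sigma>" "v \<in> vset X n \<sigma>" "u \<notin> vset X n \<sigma>" for n \<sigma>
  proof -
    obtain \<tau> where \<tau>: "\<tau> \<in> cofaces X n w \<sigma>"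
      using dominated_byD(4)[OF vw] \<sigma> by blast
    then have \<tau>': "\<tau> \<in> simplices X (Suc n)" "w \<in> vset X (Suc n) \<tau>" "u \<notin> vset X (Suc n) \<tau>"
      "face X n w \<tau> = \<sigma>"
      using \<sigma> uw vset_cofaces[OF \<tau>] by (auto simp: cofaces_def)
    obtain \<rho> where \<rho>: "\<rho> \<in> cofaces X (Suc n) u \<tau>"
      using dominated_byD(4)[OF wu] \<tau>' by blast
    \<comment> \<open>Uniqueness: every competitor \<tau>1 extends by \<open>w\<close> to some
      \<rho>1, and \<rho>1 is shown to be \<rho>.\<close>
    have "\<tau>1 = face X (Suc n) w \<rho>" if \<tau>1: "\<tau>1 \<in> cofaces X n u \<sigma>" for \<tau>1
    proof -
      have \<tau>1': "\<tau>1 \<in> simplices X (Suc n)" "vset X (Suc n) \<tau>1 = insert u (vset X n \<sigma>)"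
        "face X n u \<tau>1 = \<sigma>"
        using \<tau>1 vset_cofaces[OF \<tau>1] by (auto simp: cofaces_def)
      obtain \<rho>1 where \<rho>1: "\<rho>1 \<in> cofaces X (Suc n) w \<tau>1"
        using dominated_byD(4)[OF vw \<tau>1'(1)] \<tau>1' \<sigma> uw by auto
      \<comment> \<open>Both are cofaces of \<sigma> by \<open>w\<close>, and \<sigma> contains
        \<open>v\<close>, which is dominated by \<open>w\<close>.\<close>
      have "face X (Suc n) u \<rho>1 = \<tau>"
        using dominated_byD(5)[OF vw] cofaces_face[OF \<rho>1, of u] \<tau>1' \<tau> \<sigma> by auto
      moreover have "u \<in> vset X (Suc (Suc n)) \<rho>1"
        using vset_cofaces[OF \<rho>1] \<tau>1' by simp
      ultimately have "\<rho>1 \<in> cofaces X (Suc n) u \<tau>"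
        using \<rho>1 by (simp add: cofaces_def)
      then have "\<rho>1 = \<rho>"
        using dominated_byD(5)[OF wu _ \<rho>] \<tau>' by auto
      then show ?thesis using \<rho>1 by (simp add: cofaces_def)
    qed
    moreover have "face X (Suc n) w \<rho> \<in> cofaces X n u \<sigma>"
      using cofaces_face[OF \<rho> \<tau>'(2)] \<tau>' by simp
    ultimately show ?thesis by blast
  qed
  then show ?thesis
    using u v \<open>u \<noteq> v\<close> dominated_by_delete_vertex_iff[OF w wv uw[symmetric]] by blast
qed

end

section \<open>Isomorphisms\<close>

text \<open>The body of \<open>isomorphic\<close> with the family of maps as a parameter, so that a
  locale can fix it.\<close>

definition is_iso :: "'a delta_complex \<Rightarrow> 'b delta_complex \<Rightarrow> (nat \<Rightarrow> 'a \<Rightarrow> 'b) \<Rightarrow> bool" where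
  "is_iso X Y f \<longleftrightarrow>
     (\<forall>n. bij_betw (f n) (simplices X n) (simplices Y n)) \<and>
     (\<forall>n. \<forall>\<sigma> \<in> simplices X (Suc n).
        vset Y (Suc n) (f (Suc n) \<sigma>) = f 0 ` vset X (Suc n) \<sigma> \<and>
        (\<forall>w \<in> vset X (Suc n) \<sigma>.
           face Y n (f 0 w) (f (Suc n) \<sigma>) = f n (face X n w \<sigma>)))"

lemma isomorphic_iff: "isomorphic X Y \<longleftrightarrow> (\<exists>f. is_iso X Y f)"
  unfolding isomorphic_def is_iso_def by (rule refl)

locale delta_iso = X: delta_complex X + Y: delta_complex Y
  for X :: "'a delta_complex" and Y :: "'b delta_complex" +
  fixes f :: "nat \<Rightarrow> 'a \<Rightarrow> 'b"
  assumes iso: "is_iso X Y f"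
begin

lemma bij: "bij_betw (f n) (simplices X n) (simplices Y n)"
  and face_iso: "\<lbrakk>\<sigma> \<in> simplices X (Suc n); w \<in> vset X (Suc n) \<sigma>\<rbrakk> \<Longrightarrow>
        face Y n (f 0 w) (f (Suc n) \<sigma>) = f n (face X n w \<sigma>)"
  using iso by (simp_all add: is_iso_def)

lemma iso_in: "\<sigma> \<in> simplices X n \<Longrightarrow> f n \<sigma> \<in> simplices Y n"
  using bij bij_betwE by blast

lemma vset_iso:
  assumes "\<sigma> \<in> simplices X n"
  shows "vset Y n (f n \<sigma>) = f 0 ` vset X n \<sigma>"
proof (cases n)
  \<comment> \<open>\<open>is_iso\<close> speaks of vertex sets in positive dimension only; for a
    vertex the claim follows from \<open>V(v) = {v}\<close>.\<close>
  case 0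
  then show ?thesis using assms iso_in[of \<sigma> 0] by simp
next
  case (Suc m)
  then show ?thesis using assms iso by (simp add: is_iso_def)
qed

lemma iso_eq_iff: "\<lbrakk>\<sigma> \<in> simplices X n; \<tau> \<in> simplices X n\<rbrakk> \<Longrightarrow> f n \<sigma> = f n \<tau> \<longleftrightarrow> \<sigma> = \<tau>"
  using bij[of n] by (meson bij_betw_def inj_on_eq_iff)

lemma iso_surj: "\<sigma>' \<in> simplices Y n \<Longrightarrow> \<exists>\<sigma> \<in> simplices X n. \<sigma>' = f n \<sigma>"
  using bij[of n] by (auto simp: bij_betw_def)

lemma vset_iso_iff:
  "\<lbrakk>\<sigma> \<in> simplices X n; v \<in> simplices X 0\<rbrakk> \<Longrightarrow> f 0 v \<in> vset Y n (f n \<sigma>) \<longleftrightarrow> v \<in> vset X n \<sigma>"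
  using X.vset_subset[of \<sigma> n] iso_eq_iff[of v 0] by (auto simp: vset_iso)

lemma cofaces_iso_iff:
  assumes "\<tau> \<in> simplices X (Suc n)" "\<sigma> \<in> simplices X n" "u \<in> simplices X 0"
  shows "f (Suc n) \<tau> \<in> cofaces Y n (f 0 u) (f n \<sigma>) \<longleftrightarrow> \<tau> \<in> cofaces X n u \<sigma>"
  using assms by (auto simp: cofaces_def iso_in vset_iso_iff face_iso iso_eq_iff X.face_in_simplices)

lemma dominated_by_iso:
  assumes "dominated_by X v u"
  shows "dominated_by Y (f 0 v) (f 0 u)"
proof -
  note D = assms[unfolded X.dominated_by_iff]
  then have v: "v \<in> simplices X 0" and u: "u \<in> simplices X 0" and uv: "u \<noteq> v" by auto
  have "\<exists>!\<tau>'. \<tau>' \<in> cofaces Y n (f 0 u) \<sigma>'"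
    if \<sigma>': "\<sigma>' \<in> simplices Y n" "f 0 v \<in> vset Y n \<sigma>'" "f 0 u \<notin> vset Y n \<sigma>'" for n \<sigma>'
  proof -
    obtain \<sigma> where \<sigma>: "\<sigma> \<in> simplices X n" "\<sigma>' = f n \<sigma>"
      using iso_surj[OF \<sigma>'(1)] by blast
    then have "\<exists>!\<tau>. \<tau> \<in> cofaces X n u \<sigma>"
      using D \<sigma>' by (auto simp: vset_iso_iff)
    then obtain \<tau> where \<tau>: "\<tau> \<in> cofaces X n u \<sigma>" and
      unique: "\<And>\<tau>1. \<tau>1 \<in> cofaces X n u \<sigma> \<Longrightarrow> \<tau>1 = \<tau>" by blast
    show ?thesis
    proof (rule ex1I[of _ "f (Suc n) \<tau>"])
      show "f (Suc n) \<tau> \<in> cofaces Y n (f 0 u) \<sigma>'"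
        using \<tau> \<sigma> u cofaces_iso_iff[of \<tau> n \<sigma> u] by (auto simp: cofaces_def)
      fix \<tau>' assume \<tau>': "\<tau>' \<in> cofaces Y n (f 0 u) \<sigma>'"
      then obtain \<tau>1 where "\<tau>1 \<in> simplices X (Suc n)" "\<tau>' = f (Suc n) \<tau>1"
        using iso_surj[of \<tau>' "Suc n"] by (auto simp: cofaces_def)
      then show "\<tau>' = f (Suc n) \<tau>"
        using \<tau>' \<sigma> u unique by (auto simp: cofaces_iso_iff)
    qed
  qed
  then show ?thesis
    using u v uv by (auto simp: Y.dominated_by_iff iso_in iso_eq_iff)
qed

text \<open>The family \<open>f\<close> itself serves, since \<open>is_iso\<close> looks at its
  values on simplices only, and \<open>f\<close> preserves and reflects the containment of
  \<open>v\<close>.\<close>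

lemma is_iso_delete_vertex:
  assumes v: "v \<in> simplices X 0"
  shows "is_iso (delete_vertex X v) (delete_vertex Y (f 0 v)) f"
proof -
  have in_X: "\<sigma> \<in> simplices X n" "v \<notin> vset X n \<sigma>" if "\<sigma> \<in> simplices (delete_vertex X v) n" for n \<sigma>
    using that by (simp_all add: X.simplices_delete_vertex[OF v])
  have in_Y: "f n \<sigma> \<in> simplices (delete_vertex Y (f 0 v)) n"
    if "\<sigma> \<in> simplices (delete_vertex X v) n" for n \<sigma>
    using in_X[OF that] v by (simp add: Y.simplices_delete_vertex iso_in vset_iso_iff)
  have "bij_betw (f n) (simplices (delete_vertex X v) n) (simplices (delete_vertex Y (f 0 v)) n)" for n
    unfolding bij_betw_def
  proof
    show "inj_on (f n) (simplices (delete_vertex X v) n)"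
      using in_X iso_eq_iff by (auto simp: inj_on_def)
    have "\<sigma>' \<in> f n ` simplices (delete_vertex X v) n"
      if \<sigma>': "\<sigma>' \<in> simplices (delete_vertex Y (f 0 v)) n" for \<sigma>'
    proof -
      obtain \<sigma> where "\<sigma> \<in> simplices X n" "\<sigma>' = f n \<sigma>"
        using iso_surj[of \<sigma>' n] \<sigma>' v by (auto simp: Y.simplices_delete_vertex iso_in)
      then show ?thesis
        using \<sigma>' v
        by (auto simp: Y.simplices_delete_vertex X.simplices_delete_vertex iso_in vset_iso_iff)
    qed
    then show "f n ` simplices (delete_vertex X v) n = simplices (delete_vertex Y (f 0 v)) n"
      using in_Y by auto
  qed
  moreover have "f 0 w \<in> vset Y n (f n \<sigma>)" if "\<sigma> \<in> simplices X n" "w \<in> vset X n \<sigma>" for n \<sigma> w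
    using that by (simp add: vset_iso)
  ultimately show ?thesis
    using in_X in_Y unfolding is_iso_def
    by (simp add: X.vset_delete_vertex X.face_delete_vertex Y.vset_delete_vertex
        Y.face_delete_vertex vset_iso face_iso)
qed

lemma is_iso_inverse: "is_iso Y X (\<lambda>n. inv_into (simplices X n) (f n))" (is "is_iso Y X ?g")
proof -
  have gf: "?g n (f n \<sigma>) = \<sigma>" if "\<sigma> \<in> simplices X n" for n \<sigma>
    using that bij[of n] by (simp add: bij_betw_def)
  have "vset X n (?g n \<sigma>') = ?g 0 ` vset Y n \<sigma>'" if \<sigma>': "\<sigma>' \<in> simplices Y n" for n \<sigma>'
  proof -
    obtain \<sigma> where \<sigma>: "\<sigma> \<in> simplices X n" "\<sigma>' = f n \<sigma>"
      using iso_surj[OF \<sigma>'] by blast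
    have "?g 0 ` f 0 ` vset X n \<sigma> = vset X n \<sigma>"
      using X.vset_subset[OF \<sigma>(1)] by (force simp: gf image_image)
    then show ?thesis using \<sigma> by (simp add: gf vset_iso)
  qed
  moreover have "face X n (?g 0 w) (?g (Suc n) \<sigma>') = ?g n (face Y n w \<sigma>')"
    if \<sigma>': "\<sigma>' \<in> simplices Y (Suc n)" "w \<in> vset Y (Suc n) \<sigma>'" for n \<sigma>' w
  proof -
    obtain \<sigma> where \<sigma>: "\<sigma> \<in> simplices X (Suc n)" "\<sigma>' = f (Suc n) \<sigma>"
      using iso_surj[OF \<sigma>'(1)] by blast
    obtain u where u: "u \<in> vset X (Suc n) \<sigma>" "w = f 0 u"
      using \<sigma>'(2) \<sigma> by (auto simp: vset_iso)
    then have "u \<in> simplices X 0" using X.vset_subset \<sigma> by blast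
    then show ?thesis
      using \<sigma> u by (simp add: gf face_iso X.face_in_simplices)
  qed
  ultimately show ?thesis
    using bij_betw_inv_into[OF bij] by (simp add: is_iso_def)
qed

end

section \<open>Isomorphism as an equivalence relation\<close>

lemma isomorphic_refl: "isomorphic X X"
  unfolding isomorphic_def by (rule exI[of _ "\<lambda>n. id"]) simp

lemma isomorphic_sym:
  assumes "delta_complex X" "delta_complex Y" "isomorphic X Y"
  shows "isomorphic Y X"
proof -
  obtain f where "is_iso X Y f" using assms isomorphic_iff by blast
  then interpret delta_iso X Y f
    using assms by (simp add: delta_iso_def delta_iso_axioms_def)
  show ?thesis using is_iso_inverse isomorphic_iff by blast
qed

lemma isomorphic_trans:
  assumes "delta_complex X" "delta_complex Y" "delta_complex Z"
    and "isomorphic X Y" "isomorphic Y Z"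
  shows "isomorphic X Z"
proof -
  obtain f where "is_iso X Y f" using assms isomorphic_iff by blast
  then interpret f: delta_iso X Y f
    using assms by (simp add: delta_iso_def delta_iso_axioms_def)
  obtain g where "is_iso Y Z g" using assms isomorphic_iff by blast
  then interpret g: delta_iso Y Z g
    using assms by (simp add: delta_iso_def delta_iso_axioms_def)
  have "is_iso X Z (\<lambda>n. g n \<circ> f n)"
    unfolding is_iso_def
    by (auto simp: f.iso_in f.vset_iso f.face_iso g.vset_iso g.face_iso
        intro: bij_betw_trans[OF f.bij g.bij])
  then show ?thesis using isomorphic_iff by blast
qed

section \<open>Local confluence\<close>

text \<open>The vertex \<open>w\<close> is exchanged for \<open>v\<close>. If \<open>w\<close> is
  dominated by \<open>v\<close>, the description by \<open>THE\<close> is proper on the simplices of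
  \<open>X - v\<close> that contain \<open>w\<close>; those without \<open>w\<close> lie in both
  deletions and stay fixed.\<close>

definition swap_map :: "'a delta_complex \<Rightarrow> 'a \<Rightarrow> 'a \<Rightarrow> nat \<Rightarrow> 'a \<Rightarrow> 'a" where
  "swap_map X v w n \<sigma> =
     (if w \<in> vset X n \<sigma> then face X n w (THE \<tau>. \<tau> \<in> cofaces X n v \<sigma>) else \<sigma>)"

context delta_complex
begin

lemma swap_map_eq:
  assumes "dominated_by X w v" "w \<in> vset X n \<sigma>" "\<tau> \<in> cofaces X n v \<sigma>"
  shows "swap_map X v w n \<sigma> = face X n w \<tau>"
  using assms dominated_byD(5)[OF assms(1)] by (auto simp: swap_map_def the_equality)

text \<open>All three claims are read off one simplex \<tau> containing both \<open>v\<close> and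
  \<open>w\<close>, whose faces \<open>d_v \<tau>\<close> and \<open>d_w \<tau>\<close> are \<sigma>
  and its image.\<close>

lemma swap_map_props:
  assumes wv: "dominated_by X w v"
    and \<sigma>: "\<sigma> \<in> simplices (delete_vertex X v) n"
  shows "swap_map X v w n \<sigma> \<in> simplices (delete_vertex X w) n" (is ?in)
    and "vset X n (swap_map X v w n \<sigma>) = id(w := v) ` vset X n \<sigma>" (is ?vset)
    and "dominated_by X v w \<Longrightarrow> swap_map X w v n (swap_map X v w n \<sigma>) = \<sigma>"
proof -
  have w: "w \<in> simplices X 0" and v: "v \<in> simplices X 0" and ne: "v \<noteq> w"
    using dominated_byD[OF wv] by auto
  have \<sigma>X: "\<sigma> \<in> simplices X n" "v \<notin> vset X n \<sigma>"
    using \<sigma> by (simp_all add: simplices_delete_vertex[OF v])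
  have "?in \<and> ?vset \<and> (dominated_by X v w \<longrightarrow> swap_map X w v n (swap_map X v w n \<sigma>) = \<sigma>)"
  proof (cases "w \<in> vset X n \<sigma>")
    case False
    then have [simp]: "swap_map X v w n \<sigma> = \<sigma>" "swap_map X w v n \<sigma> = \<sigma>"
      using \<sigma>X by (simp_all add: swap_map_def)
    have "id(w := v) ` vset X n \<sigma> = vset X n \<sigma>"
      using False by (auto simp: image_iff)
    then show ?thesis
      using False \<sigma>X by (simp add: simplices_delete_vertex[OF w])
  next
    case True
    then obtain \<tau> where \<tau>: "\<tau> \<in> cofaces X n v \<sigma>"
      using dominated_byD(4)[OF wv \<sigma>X(1)] \<sigma>X by blast
    note V = vset_cofaces[OF \<tau>]
    have \<tau>': "\<tau> \<in> simplices X (Suc n)" "w \<in> vset X (Suc n) \<tau>" "face X n v \<tau> = \<sigma>"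
      using \<tau> V True by (auto simp: cofaces_def)
    have eq: "swap_map X v w n \<sigma> = face X n w \<tau>"
      by (rule swap_map_eq[OF wv True \<tau>])
    have vs: "vset X n (face X n w \<tau>) = insert v (vset X n \<sigma> - {w})"
      using vset_face[OF \<tau>'(1,2)] V ne by auto
    \<comment> \<open>\<tau> is itself a coface of \<open>d_w \<tau>\<close> by \<open>w\<close>, so
      the reverse exchange uses the same \<tau>.\<close>
    have "swap_map X w v n (face X n w \<tau>) = face X n v \<tau>" if "dominated_by X v w"
      using swap_map_eq[OF that, of n "face X n w \<tau>" \<tau>] \<tau>' vs by (auto simp: cofaces_def)
    then show ?thesis
      using eq vs ne True \<tau>'
      by (auto simp: simplices_delete_vertex[OF w] face_in_simplices image_iff)
  qed
  then show ?in ?vset "dominated_by X v w \<Longrightarrow> swap_map X w v n (swap_map X v w n \<sigma>) = \<sigma>"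
    by blast+
qed

text \<open>Let \<tau> extend \<sigma> by \<open>v\<close>, where \<sigma> contains
  \<open>w\<close>. For \<open>u = w\<close> the claim is
  \<open>d_v (d_w \<tau>) = d_w (d_v \<tau>)\<close>, and \<open>d_w \<sigma>\<close> is fixed as it
  lacks \<open>w\<close>. For other \<open>u\<close>, the face \<open>d_u \<tau>\<close> extends
  \<open>d_u \<sigma>\<close> by \<open>v\<close>, and \<open>d_u\<close> commutes with
  \<open>d_w\<close>.\<close>

lemma face_swap_map:
  assumes wv: "dominated_by X w v"
    and \<sigma>: "\<sigma> \<in> simplices (delete_vertex X v) (Suc n)" and u: "u \<in> vset X (Suc n) \<sigma>"
  shows "face X n ((id(w := v)) u) (swap_map X v w (Suc n) \<sigma>) = swap_map X v w n (face X n u \<sigma>)"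
proof (cases "w \<in> vset X (Suc n) \<sigma>")
  have w: "w \<in> simplices X 0" and v: "v \<in> simplices X 0" and ne: "v \<noteq> w"
    using dominated_byD[OF wv] by auto
  have \<sigma>X: "\<sigma> \<in> simplices X (Suc n)" "v \<notin> vset X (Suc n) \<sigma>"
    using \<sigma> by (simp_all add: simplices_delete_vertex[OF v])
  case True
  then obtain \<tau> where \<tau>: "\<tau> \<in> cofaces X (Suc n) v \<sigma>"
    using dominated_byD(4)[OF wv \<sigma>X(1)] \<sigma>X by blast
  have \<tau>': "\<tau> \<in> simplices X (Suc (Suc n))" "face X (Suc n) v \<tau> = \<sigma>"
    "vset X (Suc (Suc n)) \<tau> = insert v (vset X (Suc n) \<sigma>)"
    using \<tau> vset_cofaces[OF \<tau>] by (auto simp: cofaces_def)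
  have eq: "swap_map X v w (Suc n) \<sigma> = face X (Suc n) w \<tau>"
    by (rule swap_map_eq[OF wv True \<tau>])
  show ?thesis
  proof (cases "u = w")
    case uw: True
    have "w \<notin> vset X n (face X n w \<sigma>)"
      using \<sigma>X True by (simp add: vset_face)
    then have "swap_map X v w n (face X n w \<sigma>) = face X n w \<sigma>"
      by (simp add: swap_map_def)
    then show ?thesis
      using uw eq \<tau>' True ne face_commute[of \<tau> n v w] by simp
  next
    case uw: False
    have "swap_map X v w n (face X n u \<sigma>) = face X n w (face X (Suc n) u \<tau>)"
      using cofaces_face[OF \<tau> u] \<sigma>X True u uw by (intro swap_map_eq[OF wv]) (auto simp: vset_face)
    then show ?thesis
      using uw eq \<tau>' True u face_commute[of \<tau> n u w] by simp
  qed
next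
  case False
  moreover have "\<sigma> \<in> simplices X (Suc n)"
    using \<sigma> dominated_byD(2)[OF wv] by (simp add: simplices_delete_vertex)
  moreover have "u \<noteq> w" using False u by auto
  ultimately show ?thesis
    using u by (simp add: swap_map_def vset_face)
qed

lemma mutually_dominated_isomorphic:
  assumes vw: "dominated_by X v w" and wv: "dominated_by X w v"
  shows "isomorphic (delete_vertex X v) (delete_vertex X w)"
proof -
  have w: "w \<in> simplices X 0" and v: "v \<in> simplices X 0" and ne: "v \<noteq> w"
    using dominated_byD[OF wv] by auto
  let ?f = "swap_map X v w"
  note P = swap_map_props[OF wv]
  note Q = swap_map_props[OF vw]
  have "bij_betw (?f n) (simplices (delete_vertex X v) n) (simplices (delete_vertex X w) n)" for n
    \<comment> \<open>The inverse is the exchange with the roles of \<open>v\<close> and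
      \<open>w\<close> reversed, which is where both dominations enter.\<close>
    by (rule bij_betw_byWitness[where f' = "swap_map X w v n"]) (use P Q vw wv in auto)
  \<comment> \<open>A vertex is determined by its vertex set, so the formula for \<open>vset\<close>
    computes the map in dimension 0.\<close>
  moreover have f0: "?f 0 u = (id(w := v)) u" if "u \<in> simplices X 0" "u \<noteq> v" for u
  proof -
    have u: "u \<in> simplices (delete_vertex X v) 0"
      using that v by (simp add: simplices_delete_vertex)
    have "?f 0 u \<in> simplices X 0"
      using P(1)[OF u] w by (simp add: simplices_delete_vertex)
    then show ?thesis using P(2)[OF u] that by (auto split: if_splits)
  qed
  moreover have "u \<in> simplices X 0" "u \<noteq> v"
    if "\<sigma> \<in> simplices (delete_vertex X v) n" "u \<in> vset X n \<sigma>" for n \<sigma> u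
    using that vset_subset[of \<sigma> n] by (auto simp: simplices_delete_vertex[OF v])
  moreover have "face (delete_vertex X w) n ((id(w := v)) u) (?f (Suc n) \<sigma>) = ?f n (face X n u \<sigma>)"
    if "\<sigma> \<in> simplices (delete_vertex X v) (Suc n)" "u \<in> vset X (Suc n) \<sigma>" for n \<sigma> u
  proof -
    have "(id(w := v)) u \<in> vset X (Suc n) (?f (Suc n) \<sigma>)"
      unfolding P(2)[OF that(1)] using that(2) by (rule imageI)
    then show ?thesis
      using face_delete_vertex[OF P(1)[OF that(1)]] face_swap_map[OF wv that] by simp
  qed
  ultimately have "is_iso (delete_vertex X v) (delete_vertex X w) ?f"
    unfolding is_iso_def
    by (simp add: vset_delete_vertex face_delete_vertex P)
  then show ?thesis
    using isomorphic_iff by blast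
qed

lemma local_confluence:
  assumes "dominated X v" "dominated X w" "v \<noteq> w"
  shows "isomorphic (delete_vertex X v) (delete_vertex X w) \<or>
    dominated (delete_vertex X v) w \<and> dominated (delete_vertex X w) v"
proof -
  obtain v' w' where vv': "dominated_by X v v'" and ww': "dominated_by X w w'"
    using assms by (auto simp: dominated_def)
  have *: "v \<in> simplices X 0" "w \<in> simplices X 0" "v \<noteq> v'" "w \<noteq> w'"
    using dominated_byD[OF vv'] dominated_byD[OF ww'] by auto
  consider "v' = w" "w' = v" | "v' = w" "w' \<noteq> v" | "v' \<noteq> w" "w' = v" | "v' \<noteq> w" "w' \<noteq> v"
    by blast
  then show ?thesis
  proof cases
    case 1
    then show ?thesis using mutually_dominated_isomorphic vv' ww' by blast
  next
    case 2
    \<comment> \<open>Deleting \<open>w\<close> removes the dominating vertex of \<open>v\<close>,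
      and \<open>w'\<close> takes over by transitivity; deleting \<open>v\<close> leaves
      \<open>w'\<close> in place. The next case is symmetric.\<close>
    then have "dominated_by (delete_vertex X w) v w'" "dominated_by (delete_vertex X v) w w'"
      using dominated_by_trans dominated_by_delete_vertex vv' ww' * assms by auto
    then show ?thesis by (auto simp: dominated_def)
  next
    case 3
    then have "dominated_by (delete_vertex X v) w v'" "dominated_by (delete_vertex X w) v v'"
      using dominated_by_trans dominated_by_delete_vertex vv' ww' * assms by auto
    then show ?thesis by (auto simp: dominated_def)
  next
    case 4
    then have "dominated_by (delete_vertex X v) w w'" "dominated_by (delete_vertex X w) v v'"
      using dominated_by_delete_vertex vv' ww' * assms by auto
    then show ?thesis by (auto simp: dominated_def)
  qed
qed

section \<open>Collapses and the number of vertices\<close>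

lemma dominated_vertex: "dominated X v \<Longrightarrow> v \<in> simplices X 0"
  by (auto simp: dominated_def dominated_by_def)

lemma delta_complex_collapse:
  "elementary_strong_collapse X Y \<Longrightarrow> delta_complex Y"
  using delta_complex_delete_vertex dominated_vertex
  by (auto simp: elementary_strong_collapse_def)

text \<open>The deleted vertex itself is lost, which makes the number of vertices a measure for the
  inductions below.\<close>

lemma vertices_collapse:
  assumes "elementary_strong_collapse X Y" "finite (simplices X 0)"
  shows "finite (simplices Y 0)" "card (simplices Y 0) < card (simplices X 0)"
proof -
  obtain v where v: "v \<in> simplices X 0" "Y = delete_vertex X v"
    using assms dominated_vertex by (auto simp: elementary_strong_collapse_def)
  then have "simplices Y 0 \<subseteq> simplices X 0" "v \<notin> simplices Y 0"
    by (auto simp: simplices_delete_vertex)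
  then have "simplices Y 0 \<subset> simplices X 0"
    using v(1) by blast
  then show "finite (simplices Y 0)" "card (simplices Y 0) < card (simplices X 0)"
    using assms(2) by (auto intro: finite_subset psubset_card_mono)
qed

end

lemma delta_complex_collapses:
  "elementary_strong_collapse\<^sup>*\<^sup>* X Y \<Longrightarrow> delta_complex X \<Longrightarrow> delta_complex Y"
  by (induction rule: rtranclp_induct) (auto dest: delta_complex.delta_complex_collapse)

section \<open>Uniqueness of cores\<close>

text \<open>Minimal complexes are the normal forms of collapsing, viewed as a rewriting
  relation.\<close>

lemma minimal_iff: "minimal_complex X \<longleftrightarrow> (\<forall>Y. \<not> elementary_strong_collapse X Y)"
  by (auto simp: minimal_complex_def elementary_strong_collapse_def)

text \<open>Local confluence may end in two isomorphic complexes instead of a common one, so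
  collapses have to be carried along isomorphisms.\<close>

lemma collapse_isomorphic:
  assumes "delta_complex X" "delta_complex X'" "isomorphic X X'" "elementary_strong_collapse X Y"
  shows "\<exists>Y'. elementary_strong_collapse X' Y' \<and> isomorphic Y Y'"
proof -
  obtain f where "is_iso X X' f" using assms isomorphic_iff by blast
  then interpret delta_iso X X' f
    using assms by (simp add: delta_iso_def delta_iso_axioms_def)
  obtain v u where vu: "dominated_by X v u" "Y = delete_vertex X v"
    using assms(4) by (auto simp: elementary_strong_collapse_def dominated_def)
  then have "elementary_strong_collapse X' (delete_vertex X' (f 0 v))"
    using dominated_by_iso by (auto simp: elementary_strong_collapse_def dominated_def)
  moreover have "isomorphic Y (delete_vertex X' (f 0 v))"
    using is_iso_delete_vertex[of v] vu X.dominated_byD(1)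
    using isomorphic_iff by blast
  ultimately show ?thesis by blast
qed

lemma collapses_isomorphic:
  assumes "elementary_strong_collapse\<^sup>*\<^sup>* X Y" "delta_complex X" "delta_complex X'" "isomorphic X X'"
  shows "\<exists>Y'. elementary_strong_collapse\<^sup>*\<^sup>* X' Y' \<and> isomorphic Y Y'"
  using assms
proof (induction rule: rtranclp_induct)
  case base
  then show ?case by blast
next
  case (step Y Z)
  then obtain Y' where "elementary_strong_collapse\<^sup>*\<^sup>* X' Y'" "isomorphic Y Y'" by blast
  then show ?case
    using step collapse_isomorphic[of Y Y' Z] delta_complex_collapses rtranclp.rtrancl_into_rtrancl
    by metis
qed

text \<open>A collapse of \<open>Y\<close> would be carried to one of \<open>X\<close> by the
  inverse isomorphism.\<close>

lemma minimal_isomorphic: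
  assumes "delta_complex X" "delta_complex Y" "isomorphic X Y" "minimal_complex X"
  shows "minimal_complex Y"
  using assms collapse_isomorphic[of Y X] isomorphic_sym minimal_iff by metis

lemma minimal_collapse_exists:
  assumes "delta_complex X" "finite (simplices X 0)"
  shows "\<exists>Y. elementary_strong_collapse\<^sup>*\<^sup>* X Y \<and> minimal_complex Y"
  using assms
proof (induction "card (simplices X 0)" arbitrary: X rule: less_induct)
  case less
  show ?case
  proof (cases "minimal_complex X")
    case False
    then obtain Y where Y: "elementary_strong_collapse X Y"
      by (auto simp: minimal_iff)
    then have "\<exists>Z. elementary_strong_collapse\<^sup>*\<^sup>* Y Z \<and> minimal_complex Z"
      using less delta_complex.vertices_collapse delta_complex.delta_complex_collapse by blast
    then show ?thesis using Y converse_rtranclp_into_rtranclp by metis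
  qed blast
qed

text \<open>This is Newman's lemma up to isomorphism: both sequences are split after their first
  step, and the induction hypothesis applies to the complexes reached there.\<close>

lemma minimal_collapse_unique:
  assumes "delta_complex X" "finite (simplices X 0)"
    and "elementary_strong_collapse\<^sup>*\<^sup>* X Y" "minimal_complex Y"
    and "elementary_strong_collapse\<^sup>*\<^sup>* X Z" "minimal_complex Z"
  shows "isomorphic Y Z"
  using assms
proof (induction "card (simplices X 0)" arbitrary: X Y Z rule: less_induct)
  case less
  interpret delta_complex X by (rule less.prems(1))
  have IH: "isomorphic Y' Z'"
    if "elementary_strong_collapse X X'"
      "elementary_strong_collapse\<^sup>*\<^sup>* X' Y'" "minimal_complex Y'"
      "elementary_strong_collapse\<^sup>*\<^sup>* X' Z'" "minimal_complex Z'" for X' Y' Z'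
    using less.hyps[OF vertices_collapse(2)] vertices_collapse(1) delta_complex_collapse
      that less.prems(2) by blast
  show ?case
  proof (cases "minimal_complex X")
    case True
    then have "Y = X" "Z = X"
      using less.prems(3,5) unfolding minimal_iff by (metis converse_rtranclpE)+
    then show ?thesis by (simp add: isomorphic_refl)
  next
    case False
    \<comment> \<open>Being minimal, \<open>Y\<close> and \<open>Z\<close> differ from
      \<open>X\<close>, so both sequences have a first step.\<close>
    then have "Y \<noteq> X" "Z \<noteq> X" using less.prems by auto
    then obtain Yv Zw where Yv: "elementary_strong_collapse X Yv" "elementary_strong_collapse\<^sup>*\<^sup>* Yv Y"
      and Zw: "elementary_strong_collapse X Zw" "elementary_strong_collapse\<^sup>*\<^sup>* Zw Z"
      using less.prems(3,5) by (metis converse_rtranclpE)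
    obtain v w where v: "dominated X v" "Yv = delete_vertex X v"
      and w: "dominated X w" "Zw = delete_vertex X w"
      using Yv(1) Zw(1) by (auto simp: elementary_strong_collapse_def)
    have complexes: "delta_complex Yv" "delta_complex Zw" "delta_complex Y" "delta_complex Z"
      using Yv Zw delta_complex_collapse delta_complex_collapses by blast+
    consider "v = w" | "isomorphic Yv Zw"
      | "v \<noteq> w" "dominated (delete_vertex X v) w" "dominated (delete_vertex X w) v"
      using local_confluence v w by blast
    then show ?thesis
    proof cases
      case 1
      then show ?thesis using IH Yv Zw v w less.prems by blast
    next
      case 2
      \<comment> \<open>The sequence from \<open>Yv\<close> to \<open>Y\<close> is copied to
        \<open>Zw\<close>; its end \<open>Y'\<close> is minimal as well, so it can be compared with
        \<open>Z\<close> below \<open>Zw\<close>.\<close>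
      then obtain Y' where Y': "elementary_strong_collapse\<^sup>*\<^sup>* Zw Y'" "isomorphic Y Y'"
        using collapses_isomorphic Yv(2) complexes by blast
      have "delta_complex Y'" using Y' complexes delta_complex_collapses by blast
      moreover from this have "minimal_complex Y'"
        using minimal_isomorphic[of Y Y'] Y' complexes less.prems by blast
      then have "isomorphic Y' Z"
        using IH[OF Zw(1)] Y' Zw less.prems by blast
      ultimately show ?thesis using isomorphic_trans Y' complexes by blast
    next
      case 3
      let ?W = "delete_vertex Yv w"
      have W: "elementary_strong_collapse Yv ?W"
        using 3 v by (auto simp: elementary_strong_collapse_def)
      have W': "elementary_strong_collapse Zw ?W"
        using 3 v w delete_vertex_commute[of v w] dominated_vertex
        by (auto simp: elementary_strong_collapse_def)
      have "delta_complex ?W" "finite (simplices ?W 0)"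
        using delta_complex.delta_complex_collapse[OF _ W] complexes
          delta_complex.vertices_collapse(1)[OF _ W] vertices_collapse(1)[OF Yv(1)] less.prems(2)
        by blast+
      \<comment> \<open>A minimal complex below the common complex \<open>?W\<close> links the two
        sides: it is compared with \<open>Y\<close> below \<open>Yv\<close> and with
        \<open>Z\<close> below \<open>Zw\<close>.\<close>
      then obtain C where C: "elementary_strong_collapse\<^sup>*\<^sup>* ?W C" "minimal_complex C" "delta_complex C"
        using minimal_collapse_exists delta_complex_collapses by metis
      have "isomorphic Y C"
        using IH[OF Yv(1,2) less.prems(4)] C W converse_rtranclp_into_rtranclp by metis
      moreover have "isomorphic C Z"
        using IH[OF Zw(1) _ _ Zw(2) less.prems(6)] C W' converse_rtranclp_into_rtranclp by metis
      ultimately show ?thesis using isomorphic_trans complexes C by blast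
    qed
  qed
qed

theorem corollary3p13:
  fixes X Y Z :: "'a delta_complex"
  assumes "is_delta_complex X" and "finite_complex X"
    and "is_core Y X" and "is_core Z X"
  shows "isomorphic Y Z"
proof -
  \<comment> \<open>The induction needs finitely many vertices; these sit in
    \<open>all_simplices X\<close> tagged with dimension 0, and tagging is injective.\<close>
  have "Pair 0 ` simplices X 0 \<subseteq> all_simplices X"
    by (auto simp: all_simplices_def)
  then have "finite (Pair (0 :: nat) ` simplices X 0)"
    using assms(2) unfolding finite_complex_def by (rule finite_subset)
  then have "finite (simplices X 0)"
    by (auto dest: finite_imageD simp: inj_on_def)
  moreover have "delta_complex X"
    using assms(1) by (rule delta_complex.intro)
  ultimately show ?thesis
    using assms(3,4) minimal_collapse_unique
    unfolding is_core_def strong_collapse_def by blast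
qed

end
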